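(* Let $N$ and $p$ be positive integers, let $\hat{x}_p=(x_1,\dots,x_p)$ and $z=x_1+x_2+\cdots+x_p$. For positive integers $q$ and integers $n$ put $$a(q,n)=1-\frac{n}{qN},\qquad b(q,n)=\frac{n}{N}\left(\frac{z}{q}-1\right).$$ Then for every integer $n\ge 0$, $$S_{N,n}^{(p)}(\hat{x}_p)=\sum_{k=0}^{p-1}\left(\sum_{\sigma\in A_{p-1}(k)}\pi_{a,b}(\bar{\sigma},\sigma;n)\right)B_{N,n-k}(z),$$ where $A_{p-1}(k)$ is the set of $k$-element subsets of $\{1,2,\dots,p-1\}$ and, for $\sigma=\{i_1,\dots,i_k\}\in A_{p-1}(k)$ with complement $\bar\sigma=\{j_1,\dots,j_{p-1-k}\}$ in $\{1,\dots,p-1\}$, $$\pi_{a,b}(\bar{\sigma},\sigma;n)=\prod_{s=1}^{p-1-k}a\bigl(j_s,\,n-R_\sigma(j_s)\bigr)\ \prod_{r=1}^{k}b\bigl(i_r,\,n-R_\sigma(i_r)\bigr),\qquad R_\sigma(j)=\left|\{i\in\sigma: i>j\}\right|.$$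
   Context: For a positive integer $N$, the hypergeometric Bernoulli polynomials $B_{N,n}(x)$ of order $N$ are defined by $$\frac{(t^N/N!)\,e^{xt}}{e^t-T_{N-1}(t)}=\sum_{n=0}^\infty B_{N,n}(x)\frac{t^n}{n!},\qquad T_{N-1}(t)=\sum_{m=0}^{N-1}\frac{t^m}{m!},$$ with $B_{N,n}(x)=0$ for $n<0$. For a positive integer $p$ and $\hat{x}_p=(x_1,\dots,x_p)$, $$S_{N,n}^{(p)}(\hat{x}_p)=\sum_{i_1+i_2+\cdots+i_p=n}\frac{n!}{i_1!\,i_2!\cdots i_p!}B_{N,i_1}(x_1)B_{N,i_2}(x_2)\cdots B_{N,i_p}(x_p),$$ the sum running over nonnegative integers $i_1,\dots,i_p$, and $S_{N,n}^{(p)}(\hat{x}_p)=0$ for $n<0$. Empty products equal $1$. *)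

theory Defs
  imports "HOL-Computational_Algebra.Formal_Power_Series" "HOL-Library.FuncSet"
begin

definition trunc_exp :: "nat \<Rightarrow> 'a::field_char_0 fps" where
  "trunc_exp M = (\<Sum>m=0..M. fps_const (1 / fact m) * fps_X ^ m)"

definition hyp_bernoulli_gf :: "nat \<Rightarrow> 'a::field_char_0 \<Rightarrow> 'a fps" where
  "hyp_bernoulli_gf N x =
     (fps_const (1 / fact N) * fps_X ^ N * fps_exp x) / (fps_exp 1 - trunc_exp (N - 1))"

definition hyp_bernoulli :: "nat \<Rightarrow> int \<Rightarrow> 'a::field_char_0 \<Rightarrow> 'a" where
  "hyp_bernoulli N n x =
     (if n < 0 then 0 else fact (nat n) * fps_nth (hyp_bernoulli_gf N x) (nat n))"

text \<open>The denominator has order exactly \<open>N\<close> at \<open>0\<close>, so the quotient of power series above is an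
  exact one (division of power series in the library may otherwise discard low-order terms).\<close>

lemma hyp_bernoulli_generating_function:
  fixes x :: "'a::field_char_0"
  assumes "N \<ge> 1"
  shows "Abs_fps (\<lambda>n. hyp_bernoulli N (int n) x / fact n) * (fps_exp 1 - trunc_exp (N - 1)) =
           fps_const (1 / fact N) * fps_X ^ N * fps_exp x"
proof -
  let ?g = "fps_exp 1 - trunc_exp (N - 1) :: 'a fps"
  let ?f = "fps_const (1 / fact N) * fps_X ^ N * fps_exp x"
  have T: "fps_nth (trunc_exp (N - 1) :: 'a fps) k = (if k < N then 1 / fact k else 0)" for k
    using assms by (auto simp: trunc_exp_def fps_sum_nth fps_X_power_nth if_distrib
        sum.delta' cong: if_cong)
  have "subdegree ?g = N"
    by (rule subdegreeI) (auto simp: T simp del: One_nat_def)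
  moreover have "?g \<noteq> 0"
  proof
    assume "?g = 0"
    then have "fps_nth ?g N = 0" by simp
    then show False by (simp add: T del: One_nat_def)
  qed
  moreover have "subdegree ?f = N"
    by (rule subdegreeI) (auto simp: fps_X_power_mult_nth mult.assoc)
  moreover have "fps_nth ?f N \<noteq> 0"
    by (simp add: fps_X_power_mult_nth mult.assoc)
  then have "?f \<noteq> 0"
    by (metis fps_zero_nth)
  ultimately have "?g dvd ?f"
    by (simp add: fps_dvd_iff)
  moreover have "Abs_fps (\<lambda>n. hyp_bernoulli N (int n) x / fact n) = ?f / ?g"
    by (rule fps_ext) (simp add: hyp_bernoulli_def hyp_bernoulli_gf_def)
  ultimately show ?thesis
    by (simp only: dvd_div_mult_self)
qed

text \<open>The tuple \<open>(x\<^sub>1, \<dots>, x\<^sub>p)\<close> is a function of which only the values on \<open>{1..p}\<close> matter; the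
  index tuples are extensional functions, so that each one is counted once.\<close>

definition hyp_bernoulli_sum :: "nat \<Rightarrow> nat \<Rightarrow> int \<Rightarrow> (nat \<Rightarrow> 'a::field_char_0) \<Rightarrow> 'a" where
  "hyp_bernoulli_sum N p n x =
     (if n < 0 then 0
      else \<Sum>i \<in> {i \<in> {1..p} \<rightarrow>\<^sub>E (UNIV :: nat set). int (\<Sum>j=1..p. i j) = n}.
             fact (nat n) / (\<Prod>j=1..p. fact (i j)) *
             (\<Prod>j=1..p. hyp_bernoulli N (int (i j)) (x j)))"

lemma finite_index_tuples:
  fixes p :: nat
  shows "finite {i \<in> {1..p} \<rightarrow>\<^sub>E (UNIV :: nat set). int (\<Sum>j=1..p. i j) = n}"
proof (rule finite_subset)
  show "{i \<in> {1..p} \<rightarrow>\<^sub>E (UNIV :: nat set). int (\<Sum>j=1..p. i j) = n}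
          \<subseteq> {1..p} \<rightarrow>\<^sub>E {..nat n}"
  proof
    fix i assume "i \<in> {i \<in> {1..p} \<rightarrow>\<^sub>E (UNIV :: nat set). int (\<Sum>j=1..p. i j) = n}"
    then have i: "i \<in> {1..p} \<rightarrow>\<^sub>E (UNIV :: nat set)" and "nat n = (\<Sum>j=1..p. i j)"
      by (auto simp flip: of_nat_sum)
    then have "i j \<le> nat n" if "j \<in> {1..p}" for j
      using that by (simp only: member_le_sum finite_atLeastAtMost zero_le)
    with i show "i \<in> {1..p} \<rightarrow>\<^sub>E {..nat n}"
      by (auto simp: PiE_iff)
  qed
  show "finite ({1..p} \<rightarrow>\<^sub>E {..nat n})"
    by (intro finite_PiE) auto
qed

definition coeff_a :: "nat \<Rightarrow> nat \<Rightarrow> int \<Rightarrow> 'a::field_char_0" where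
  "coeff_a N q n = 1 - of_int n / (of_nat q * of_nat N)"

definition coeff_b :: "nat \<Rightarrow> 'a \<Rightarrow> nat \<Rightarrow> int \<Rightarrow> 'a::field_char_0" where
  "coeff_b N z q n = of_int n / of_nat N * (z / of_nat q - 1)"

definition subsets_of_size :: "nat \<Rightarrow> nat \<Rightarrow> nat set set" where
  "subsets_of_size m k = {\<sigma>. \<sigma> \<subseteq> {1..m} \<and> card \<sigma> = k}"

definition num_above :: "nat set \<Rightarrow> nat \<Rightarrow> nat" where
  "num_above \<sigma> j = card {i \<in> \<sigma>. i > j}"

definition weight ::
  "(nat \<Rightarrow> int \<Rightarrow> 'a) \<Rightarrow> (nat \<Rightarrow> int \<Rightarrow> 'a) \<Rightarrow> nat set \<Rightarrow> nat set \<Rightarrow> int \<Rightarrow> 'a::field_char_0" where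
  "weight a b \<tau> \<sigma> n =
     (\<Prod>j\<in>\<tau>. a j (n - int (num_above \<sigma> j))) * (\<Prod>i\<in>\<sigma>. b i (n - int (num_above \<sigma> i)))"

end

theory Submission
  imports Defs
begin

text \<open>
  Write \<open>F\<close> for the generating function of the numbers \<open>B\<^sub>N\<^sub>,\<^sub>n(0)\<close>. Since the generating function of
  \<open>B\<^sub>N\<^sub>,\<^sub>n(x)\<close> is \<open>F e\<^bsup>xt\<^esup>\<close> (\<open>gf_exp_split\<close>), the one of \<open>S\<^sub>N\<^sub>,\<^sub>n(x\<^sub>1, \<dots>, x\<^sub>p)\<close> is
  \<open>F\<^sup>p e\<^bsup>zt\<^esup>\<close>, which depends on the tuple only through its sum \<open>z\<close>
  (\<open>hyp_bernoulli_sum_eq_power_coeff\<close>). With \<open>z\<close> fixed, it remains to lower the exponent from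
  \<open>p\<close> to \<open>1\<close>.

  The denominator \<open>D = e\<^sup>t - T\<^sub>N\<^sub>-\<^sub>1\<close> satisfies \<open>D' = D + t\<^bsup>N-1\<^esup>/(N-1)!\<close>, and
  differentiating \<open>F D = t\<^sup>N/N!\<close> turns this into the Riccati equation
  \<open>N F\<^sup>2 = N F - t F - t F'\<close> (\<open>gf_riccati\<close>). It expresses the square \<open>F\<^sup>2\<close> linearly in
  \<open>F\<close> and \<open>F'\<close>; multiplied by \<open>q F\<^bsup>q-1\<^esup> e\<^bsup>zt\<^esup>\<close>, it expresses
  \<open>H\<^sub>q\<^sub>+\<^sub>1\<close> linearly in \<open>H\<^sub>q\<close> and \<open>H\<^sub>q'\<close>, where \<open>H\<^sub>q = F\<^sup>q e\<^bsup>zt\<^esup>\<close>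
  (\<open>power_gf_recurrence\<close>). On the coefficients \<open>h\<^sub>q(n)\<close> of \<open>t\<^sup>n/n!\<close> this reads
  \<open>h\<^sub>q\<^sub>+\<^sub>1(n) = a(q,n) h\<^sub>q(n) + b(q,n) h\<^sub>q(n-1)\<close> (\<open>power_coeff_recurrence\<close>).

  Unrolling such a recurrence from \<open>q = p - 1\<close> down to \<open>q = 1\<close>, one chooses for each \<open>q\<close>
  either the term with \<open>a\<close> or the one with \<open>b\<close>. Let \<open>\<sigma>\<close> be the set of those \<open>q\<close> for which
  \<open>b\<close> is chosen. On reaching \<open>q\<close>, the argument \<open>n\<close> has been lowered once for every
  element of \<open>\<sigma>\<close> above \<open>q\<close>, that is by \<open>R\<^sub>\<sigma>(q)\<close>, and in the end it has been lowered by
  the size of \<open>\<sigma>\<close>. Hence the sum over all \<open>\<sigma>\<close> with the weights of the theorem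
  (\<open>two_term_recurrence_solution\<close>).
\<close>

section \<open>Unrolling a two-term recurrence\<close>

text \<open>How the first step of the unrolling changes the weight: a new top element \<open>m + 1\<close> has nothing
  above it, so its own factor is evaluated at \<open>n\<close>; if it lies in the set, it is above all the other
  indices and lowers each of their arguments by one.\<close>

lemma weight_Suc:
  fixes a b :: "nat \<Rightarrow> int \<Rightarrow> 'a::field_char_0"
  assumes "\<sigma> \<subseteq> {1..m}"
  shows "weight a b ({1..Suc m} - \<sigma>) \<sigma> n = a (Suc m) n * weight a b ({1..m} - \<sigma>) \<sigma> n"
    and "weight a b ({1..Suc m} - insert (Suc m) \<sigma>) (insert (Suc m) \<sigma>) n =
           b (Suc m) n * weight a b ({1..m} - \<sigma>) \<sigma> (n - 1)"
proof -
  have fin: "finite \<sigma>" and notin: "Suc m \<notin> \<sigma>"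
    using assms finite_subset by auto
  have le: "j \<le> m" if "j \<in> \<sigma>" for j using assms that by auto
  have "{i \<in> \<sigma>. i > Suc m} = {}" and "{i \<in> insert (Suc m) \<sigma>. i > Suc m} = {}"
    using le by force+
  then have top: "num_above \<sigma> (Suc m) = 0" "num_above (insert (Suc m) \<sigma>) (Suc m) = 0"
    unfolding num_above_def by (simp_all only: card.empty)
  have "{i \<in> insert (Suc m) \<sigma>. i > j} = insert (Suc m) {i \<in> \<sigma>. i > j}" if "j \<le> m" for j
    using that by auto
  then have below: "num_above (insert (Suc m) \<sigma>) j = Suc (num_above \<sigma> j)" if "j \<le> m" for j
    using that fin notin by (simp add: num_above_def)
  have "{1..Suc m} - \<sigma> = insert (Suc m) ({1..m} - \<sigma>)"
    using notin by auto
  then show "weight a b ({1..Suc m} - \<sigma>) \<sigma> n = a (Suc m) n * weight a b ({1..m} - \<sigma>) \<sigma> n"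
    by (simp add: weight_def top)
  have "{1..Suc m} - insert (Suc m) \<sigma> = {1..m} - \<sigma>"
    by auto
  moreover have "(\<Prod>j\<in>{1..m} - \<sigma>. a j (n - int (num_above (insert (Suc m) \<sigma>) j))) =
      (\<Prod>j\<in>{1..m} - \<sigma>. a j (n - 1 - int (num_above \<sigma> j)))"
    by (intro prod.cong) (auto simp: below algebra_simps)
  moreover have "(\<Prod>j\<in>\<sigma>. b j (n - int (num_above (insert (Suc m) \<sigma>) j))) =
      (\<Prod>j\<in>\<sigma>. b j (n - 1 - int (num_above \<sigma> j)))"
    by (intro prod.cong) (auto simp: below le algebra_simps)
  ultimately show "weight a b ({1..Suc m} - insert (Suc m) \<sigma>) (insert (Suc m) \<sigma>) n =
           b (Suc m) n * weight a b ({1..m} - \<sigma>) \<sigma> (n - 1)"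
    using fin notin by (simp add: weight_def top)
qed

text \<open>The recurrence is applied at the top index; whether the top index belongs to \<open>\<sigma>\<close> tells
  which of its two terms is followed. The induction needs \<open>n\<close> arbitrary (and of type \<open>int\<close>) because
  the second term shifts it.\<close>

lemma two_term_recurrence_solution:
  fixes a b h :: "nat \<Rightarrow> int \<Rightarrow> 'a::field_char_0"
  assumes "\<And>q n. q \<ge> 1 \<Longrightarrow> h (Suc q) n = a q n * h q n + b q n * h q (n - 1)"
  shows "h (Suc m) n =
           (\<Sum>\<sigma>\<in>Pow {1..m}. weight a b ({1..m} - \<sigma>) \<sigma> n * h 1 (n - int (card \<sigma>)))"
proof (induction m arbitrary: n)
  case 0
  show ?case by (simp add: weight_def)
next
  case (Suc m)
  let ?w = "\<lambda>m \<sigma> n. weight a b ({1..m} - \<sigma>) \<sigma> n"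
  have interval: "{1..Suc m} = insert (Suc m) {1..m}" by auto
  have inj: "inj_on (insert (Suc m)) (Pow {1..m})"
    by (rule inj_on_inverseI[where g = "\<lambda>\<tau>. \<tau> - {Suc m}"]) auto
  have "(\<Sum>\<sigma>\<in>Pow {1..Suc m}. ?w (Suc m) \<sigma> n * h 1 (n - int (card \<sigma>))) =
      (\<Sum>\<sigma>\<in>Pow {1..m}. ?w (Suc m) \<sigma> n * h 1 (n - int (card \<sigma>))) +
      (\<Sum>\<sigma>\<in>insert (Suc m) ` Pow {1..m}. ?w (Suc m) \<sigma> n * h 1 (n - int (card \<sigma>)))"
    by (subst interval, subst Pow_insert, rule sum.union_disjoint) auto
  also have "(\<Sum>\<sigma>\<in>insert (Suc m) ` Pow {1..m}. ?w (Suc m) \<sigma> n * h 1 (n - int (card \<sigma>))) =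
      (\<Sum>\<sigma>\<in>Pow {1..m}. ?w (Suc m) (insert (Suc m) \<sigma>) n *
          h 1 (n - int (card (insert (Suc m) \<sigma>))))"
    by (simp only: sum.reindex[OF inj] comp_def)
  also have "\<dots> = (\<Sum>\<sigma>\<in>Pow {1..m}. b (Suc m) n * (?w m \<sigma> (n - 1) * h 1 (n - 1 - int (card \<sigma>))))"
  proof (rule sum.cong[OF refl])
    fix \<sigma> assume "\<sigma> \<in> Pow {1..m}"
    then have sub: "\<sigma> \<subseteq> {1..m}" by simp
    then have "card (insert (Suc m) \<sigma>) = Suc (card \<sigma>)"
      by (subst card_insert_disjoint) (auto intro: finite_subset)
    then have "n - int (card (insert (Suc m) \<sigma>)) = n - 1 - int (card \<sigma>)" by simp
    then show "?w (Suc m) (insert (Suc m) \<sigma>) n * h 1 (n - int (card (insert (Suc m) \<sigma>))) =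
        b (Suc m) n * (?w m \<sigma> (n - 1) * h 1 (n - 1 - int (card \<sigma>)))"
      by (simp only: weight_Suc(2)[OF sub] mult.assoc)
  qed
  also have "\<dots> = b (Suc m) n * h (Suc m) (n - 1)"
    by (simp add: Suc.IH[of "n - 1"] sum_distrib_left)
  also have "(\<Sum>\<sigma>\<in>Pow {1..m}. ?w (Suc m) \<sigma> n * h 1 (n - int (card \<sigma>))) =
      a (Suc m) n * h (Suc m) n"
    unfolding Suc.IH[of n] sum_distrib_left
    by (intro sum.cong refl) (simp only: weight_Suc(1) Pow_iff mult.assoc)
  finally show ?case
    using assms[of "Suc m" n] by simp
qed

section \<open>The generating function\<close>

text \<open>\<open>e\<^sup>t\<close> is its own derivative, while \<open>T\<^sub>N\<^sub>-\<^sub>1\<close> loses its top term under differentiation.\<close>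

lemma fps_deriv_denom:
  assumes "N \<ge> 1"
  shows "fps_deriv (fps_exp 1 - trunc_exp (N - 1) :: 'a::field_char_0 fps) =
    (fps_exp 1 - trunc_exp (N - 1)) + fps_const (1 / fact (N - 1)) * fps_X ^ (N - 1)"
proof (rule fps_ext)
  fix k
  have nth: "fps_nth (trunc_exp (N - 1) :: 'a fps) k = (if k < N then 1 / fact k else 0)" for k
    using assms by (auto simp: trunc_exp_def fps_sum_nth fps_X_power_nth if_distrib
        sum.delta' cong: if_cong)
  have fact_ratio: "of_nat (Suc k) * (1 / fact (Suc k)) = (1 / fact k :: 'a)"
    by (simp add: divide_simps del: of_nat_Suc)
  have "fps_nth (fps_deriv (fps_exp 1 - trunc_exp (N - 1) :: 'a fps)) k =
      of_nat (Suc k) * (1 / fact (Suc k)) - of_nat (Suc k) * (if Suc k < N then 1 / fact (Suc k) else 0)"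
    by (simp only: fps_deriv_nth fps_sub_nth nth fps_exp_nth power_one of_nat_fact
        right_diff_distrib Suc_eq_plus1)
  also have "\<dots> = 1 / fact k - (if Suc k < N then 1 / fact k else 0)"
    by (simp only: fact_ratio if_distrib[of "(*) _"] mult_zero_right)
  also have "\<dots> = fps_nth ((fps_exp 1 - trunc_exp (N - 1)) +
      fps_const (1 / fact (N - 1)) * fps_X ^ (N - 1)) k"
    using assms by (auto simp: nth fps_X_power_nth simp del: One_nat_def)
  finally show "fps_nth (fps_deriv (fps_exp 1 - trunc_exp (N - 1) :: 'a fps)) k =
      fps_nth ((fps_exp 1 - trunc_exp (N - 1)) + fps_const (1 / fact (N - 1)) * fps_X ^ (N - 1)) k" .
qed

text \<open>The division defining the generating function is exact, so it can be replaced by this product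
  in what follows.\<close>

lemma gf_mult_denom:
  fixes x :: "'a::field_char_0"
  assumes "N \<ge> 1"
  shows "hyp_bernoulli_gf N x * (fps_exp 1 - trunc_exp (N - 1)) =
           fps_const (1 / fact N) * fps_X ^ N * fps_exp x"
proof -
  have "Abs_fps (\<lambda>n. hyp_bernoulli N (int n) x / fact n) = hyp_bernoulli_gf N x"
    by (rule fps_ext) (simp add: hyp_bernoulli_def)
  then show ?thesis
    using hyp_bernoulli_generating_function[OF assms, of x] by simp
qed

lemma denom_nonzero:
  assumes "N \<ge> 1"
  shows "(fps_exp 1 - trunc_exp (N - 1) :: 'a::field_char_0 fps) \<noteq> 0"
proof
  assume "(fps_exp 1 - trunc_exp (N - 1) :: 'a fps) = 0"
  then have "fps_const (1 / fact N) * fps_X ^ N * fps_exp 0 = (0 :: 'a fps)"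
    using gf_mult_denom[OF assms, of "0 :: 'a"] by (simp only: mult_zero_right)
  then show False by simp
qed

lemma gf_exp_split:
  fixes x :: "'a::field_char_0"
  assumes "N \<ge> 1"
  shows "hyp_bernoulli_gf N x = hyp_bernoulli_gf N 0 * fps_exp x"
proof -
  let ?D = "fps_exp 1 - trunc_exp (N - 1) :: 'a fps"
  have "hyp_bernoulli_gf N x * ?D = (hyp_bernoulli_gf N 0 * ?D) * fps_exp x"
    unfolding gf_mult_denom[OF assms] by simp
  then have "hyp_bernoulli_gf N x * ?D = (hyp_bernoulli_gf N 0 * fps_exp x) * ?D"
    by (simp only: mult_ac)
  then show ?thesis
    using mult_right_cancel[OF denom_nonzero[OF assms, where 'a = 'a]] by blast
qed

text \<open>The equation that linearises squares: by the product rule,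
  \<open>F' D + F (D + N M) = N M\<close> with \<open>M = t\<^bsup>N-1\<^esup>/N!\<close>; after multiplication by \<open>F\<close> every occurrence
  of \<open>D\<close> is in a product \<open>F D = t M\<close>, and \<open>M\<close> cancels.\<close>

lemma gf_riccati:
  fixes N :: nat
  defines "F \<equiv> hyp_bernoulli_gf N (0 :: 'a::field_char_0)"
  assumes "N \<ge> 1"
  shows "of_nat N * F ^ 2 = of_nat N * F - fps_X * F - fps_X * fps_deriv (F)"
proof -
  let ?D = "fps_exp 1 - trunc_exp (N - 1) :: 'a fps"
  let ?c = "fps_const (1 / fact N) :: 'a fps"
  define M where "M = ?c * fps_X ^ (N - 1)"
  have num: "?c * fps_X ^ N = fps_X * M"
    using assms(2) by (cases N) (simp_all add: M_def mult_ac)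
  have "fact (N - 1) * of_nat N = (fact N :: 'a)"
    using assms(2) by (simp add: fact_reduce mult.commute)
  then have "1 / fact (N - 1) = (of_nat N * (1 / fact N) :: 'a)"
    by (simp add: divide_simps mult.commute)
  then have "fps_const (1 / fact (N - 1)) = (of_nat N * ?c :: 'a fps)"
    by (simp add: fps_of_nat [symmetric])
  then have D': "fps_deriv ?D = ?D + of_nat N * M"
    unfolding fps_deriv_denom[OF assms(2)] by (simp add: M_def mult.assoc)
  have FD: "F * ?D = fps_X * M"
    using gf_mult_denom[OF assms(2), of "0::'a"] num by (simp add: F_def)
  have "fps_deriv (?c * fps_X ^ N) = of_nat N * M"
    by (simp add: fps_deriv_power' M_def mult_ac)
  then have "fps_deriv (F * ?D) = of_nat N * M"
    by (simp only: FD num)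
  then have deriv: "fps_deriv F * ?D + F * ?D + of_nat N * F * M = of_nat N * M"
    by (simp only: fps_deriv_mult D') (simp add: algebra_simps)
  \<comment> \<open>multiplied by \<open>F\<close>, so that \<open>D\<close> occurs only in \<open>F D\<close>\<close>
  have "of_nat N * M * F = fps_deriv F * (F * ?D) + F * (F * ?D) + of_nat N * F ^ 2 * M"
    by (subst deriv[symmetric]) (simp add: algebra_simps power2_eq_square)
  then have "M * (of_nat N * F ^ 2) = M * (of_nat N * F - fps_X * F - fps_X * fps_deriv F)"
    unfolding FD by (simp add: algebra_simps)
  moreover have "M \<noteq> 0" by (simp add: M_def)
  ultimately show ?thesis by simp
qed

text \<open>The Riccati equation multiplied by \<open>q F\<^bsup>q-1\<^esup> e\<^bsup>zt\<^esup>\<close>: the term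
  \<open>q F\<^bsup>q-1\<^esup> F' e\<^bsup>zt\<^esup>\<close> which then appears is \<open>H\<^sub>q' - z H\<^sub>q\<close>.\<close>

lemma power_gf_recurrence:
  fixes N q :: nat and z :: "'a::field_char_0"
  defines "H \<equiv> \<lambda>q. hyp_bernoulli_gf N (0::'a) ^ q * fps_exp z"
  assumes "N \<ge> 1" and "q \<ge> 1"
  shows "of_nat (q * N) * H (Suc q) =
    of_nat (q * N) * H q - fps_X * fps_deriv (H q)
      + fps_const (z - of_nat q) * (fps_X * H q)"
proof -
  let ?F = "hyp_bernoulli_gf N (0::'a)"
  obtain r where q: "q = Suc r" using assms(3) by (cases q) auto
  have power_q: "?F ^ q = ?F * ?F ^ r" by (simp add: q)
  have deriv: "fps_deriv (H q) = of_nat q * ?F ^ r * fps_deriv ?F * fps_exp z + fps_const z * H q"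
    by (simp add: H_def q fps_deriv_power' algebra_simps del: power_Suc of_nat_Suc)
  have "of_nat (q * N) * H (Suc q) = of_nat q * ?F ^ r * fps_exp z * (of_nat N * ?F ^ 2)"
    by (simp add: H_def power_q power2_eq_square algebra_simps)
  also have "\<dots> = of_nat q * ?F ^ r * fps_exp z * (of_nat N * ?F - fps_X * ?F - fps_X * fps_deriv ?F)"
    by (simp only: gf_riccati[OF assms(2)])
  also have "\<dots> = of_nat (q * N) * H q - fps_X * fps_deriv (H q)
      + fps_const (z - of_nat q) * (fps_X * H q)"
    unfolding deriv
    by (simp add: H_def power_q algebra_simps fps_of_nat del: of_nat_Suc flip: fps_const_sub)
  finally show ?thesis .
qed

section \<open>Coefficients of the powers\<close>

text \<open>The value \<open>0\<close> at negative \<open>n\<close> makes the recurrence below hold for every integer \<open>n\<close>.\<close>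

definition power_coeff :: "nat \<Rightarrow> 'a \<Rightarrow> nat \<Rightarrow> int \<Rightarrow> 'a::field_char_0" where
  "power_coeff N z q n = (if n < 0 then 0
     else fact (nat n) * fps_nth (hyp_bernoulli_gf N 0 ^ q * fps_exp z) (nat n))"

text \<open>Multiplication by \<open>t\<close> takes the coefficient of \<open>t\<^sup>n/n!\<close> to \<open>n\<close> times the previous
  one, and \<open>t d/dt\<close> multiplies it by \<open>n\<close>. Thus \<open>power_gf_recurrence\<close>, divided by \<open>q N\<close>, has exactly
  the coefficients \<open>a(q,n)\<close> and \<open>b(q,n)\<close>.\<close>

lemma power_coeff_recurrence:
  fixes z :: "'a::field_char_0"
  assumes "N \<ge> 1" and "q \<ge> 1"
  shows "power_coeff N z (Suc q) n =
    coeff_a N q n * power_coeff N z q n + coeff_b N z q n * power_coeff N z q (n - 1)"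
proof (cases "n < 0")
  case True
  then show ?thesis by (simp add: power_coeff_def)
next
  case False
  then obtain k where n: "n = int k" by (metis nonneg_int_cases not_less)
  define H where "H q = hyp_bernoulli_gf N (0::'a) ^ q * fps_exp z" for q
  have nz: "(of_nat q :: 'a) \<noteq> 0" "(of_nat N :: 'a) \<noteq> 0" using assms by auto
  have nth: "fps_nth (of_nat i * f) j = of_nat i * fps_nth f j"
    "fps_nth (fps_X * fps_deriv f) j = of_nat j * fps_nth f j" for i j and f :: "'a fps"
    by (simp_all only: fps_mult_fps_X_deriv_shift fps_of_nat[symmetric] fps_mult_left_const_nth) simp
  have step: "of_nat (q * N) * fps_nth (H (Suc q)) k = of_nat (q * N) * fps_nth (H q) k
      - of_nat k * fps_nth (H q) k
      + (z - of_nat q) * (if k = 0 then 0 else fps_nth (H q) (k - 1))"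
    using arg_cong[OF power_gf_recurrence[OF assms, of z], of "\<lambda>f. fps_nth f k", folded H_def]
    by (simp only: fps_add_nth fps_sub_nth nth fps_mult_left_const_nth fps_X_mult_nth[of "H q"])
  have prev: "power_coeff N z q (n - 1) = (if k = 0 then 0 else fact (k - 1) * fps_nth (H q) (k - 1))"
    by (cases k) (simp_all add: power_coeff_def n H_def)
  have curr: "power_coeff N z i n = fact k * fps_nth (H i) k" for i
    by (simp add: power_coeff_def n H_def)
  have "of_nat (q * N) * power_coeff N z (Suc q) n = (of_nat (q * N) - of_nat k) * power_coeff N z q n
      + of_nat k * (z - of_nat q) * power_coeff N z q (n - 1)"
  proof (cases k)
    case 0
    with step show ?thesis by (simp add: curr prev)
  next
    case (Suc k')
    have "of_nat (q * N) * (fact k * fps_nth (H (Suc q)) k) =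
        fact k * (of_nat (q * N) * fps_nth (H (Suc q)) k)"
      by (simp only: mult_ac)
    then show ?thesis
      unfolding curr prev step using Suc by (simp add: algebra_simps)
  qed
  then have "power_coeff N z (Suc q) n = ((of_nat (q * N) - of_nat k) * power_coeff N z q n
      + of_nat k * (z - of_nat q) * power_coeff N z q (n - 1)) / of_nat (q * N)"
    using nz by (simp add: field_simps)
  moreover have "coeff_a N q n = (of_nat (q * N) - of_nat k) / (of_nat (q * N) :: 'a)"
    using nz by (simp add: coeff_a_def n diff_divide_distrib)
  moreover have "coeff_b N z q n = of_nat k * (z - of_nat q) / of_nat (q * N)"
    using nz by (simp add: coeff_b_def n field_simps)
  ultimately show ?thesis
    by (simp add: add_divide_distrib)
qed

lemma power_coeff_one:
  assumes "N \<ge> 1"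
  shows "power_coeff N z 1 n = hyp_bernoulli N n z"
  unfolding power_coeff_def hyp_bernoulli_def gf_exp_split[OF assms, of z] power_one_right ..

text \<open>A multiset of size \<open>n\<close> on \<open>A\<close> is the same as its multiplicity function; this turns the
  multiset expansion \<open>fps_prod_nth'\<close> into a sum over index tuples.\<close>

lemma fps_prod_nth_PiE:
  fixes f :: "'i \<Rightarrow> 'a::comm_ring_1 fps"
  assumes "finite A"
  shows "fps_nth (\<Prod>j\<in>A. f j) n =
    (\<Sum>i\<in>{i \<in> A \<rightarrow>\<^sub>E (UNIV :: nat set). (\<Sum>j\<in>A. i j) = n}. \<Prod>j\<in>A. fps_nth (f j) (i j))"
proof -
  have count: "count (\<Sum>j\<in>A. replicate_mset (i j) j) k = (if k \<in> A then i k else 0)"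
    for i :: "'i \<Rightarrow> nat" and k
    using assms by (simp add: count_sum sum.delta)
  have supp: "count X j = 0" if "set_mset X \<subseteq> A" "j \<notin> A" for X j
    using that by (auto simp: count_eq_zero_iff)
  have size: "size X = (\<Sum>j\<in>A. count X j)" if "set_mset X \<subseteq> A" for X
    unfolding size_multiset_overloaded_eq using that assms
    by (intro sum.mono_neutral_left) (auto simp: count_eq_zero_iff)
  have "fps_nth (\<Prod>j\<in>A. f j) n = (\<Sum>X\<in>multisets_of_size A n. \<Prod>j\<in>A. fps_nth (f j) (count X j))"
    by (rule fps_prod_nth'[OF assms])
  also have "\<dots> = (\<Sum>i\<in>{i \<in> A \<rightarrow>\<^sub>E (UNIV :: nat set). (\<Sum>j\<in>A. i j) = n}.
                     \<Prod>j\<in>A. fps_nth (f j) (i j))"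
    by (rule sum.reindex_bij_witness[where j = "\<lambda>X. restrict (count X) A"
          and i = "\<lambda>i. \<Sum>j\<in>A. replicate_mset (i j) j"])
       (auto simp: multisets_of_size_def count size supp multiset_eq_iff set_mset_sum assms
          PiE_def extensional_def restrict_def fun_eq_iff split: if_splits)
  finally show ?thesis .
qed

lemma fps_exp_sum: "finite A \<Longrightarrow> (\<Prod>j\<in>A. fps_exp (x j)) = fps_exp (\<Sum>j\<in>A. x j :: 'a::field_char_0)"
  by (induction A rule: finite_induct) (simp_all add: fps_exp_add_mult)

text \<open>The factorials of the multinomial coefficient cancel those in the \<open>B\<^sub>N\<^sub>,\<^sub>i(x\<^sub>j)\<close>, which leaves
  the coefficient of a product of power series.\<close>

lemma hyp_bernoulli_sum_eq_power_coeff: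
  fixes x :: "nat \<Rightarrow> 'a::field_char_0"
  assumes "N \<ge> 1"
  shows "hyp_bernoulli_sum N p n x = power_coeff N (\<Sum>j=1..p. x j) p n"
proof (cases "n < 0")
  case True
  then show ?thesis by (simp add: hyp_bernoulli_sum_def power_coeff_def)
next
  case False
  have "(\<Prod>j=1..p. hyp_bernoulli_gf N (x j)) = hyp_bernoulli_gf N 0 ^ p * fps_exp (\<Sum>j=1..p. x j)"
    by (subst gf_exp_split[OF assms]) (simp add: prod.distrib fps_exp_sum)
  then have nth: "fps_nth (hyp_bernoulli_gf N 0 ^ p * fps_exp (\<Sum>j=1..p. x j)) (nat n) =
      (\<Sum>i\<in>{i \<in> {1..p} \<rightarrow>\<^sub>E (UNIV :: nat set). (\<Sum>j=1..p. i j) = nat n}.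
         \<Prod>j=1..p. fps_nth (hyp_bernoulli_gf N (x j)) (i j))"
    by (simp only: fps_prod_nth_PiE finite_atLeastAtMost flip: \<open>_ = _\<close>)
  have index: "int s = n \<longleftrightarrow> s = nat n" for s using False by auto
  have summand: "fact (nat n) / (\<Prod>j=1..p. fact (i j)) * (\<Prod>j=1..p. hyp_bernoulli N (int (i j)) (x j)) =
      fact (nat n) * (\<Prod>j=1..p. fps_nth (hyp_bernoulli_gf N (x j)) (i j))" for i
    by (simp add: hyp_bernoulli_def prod.distrib)
  show ?thesis
    unfolding hyp_bernoulli_sum_def power_coeff_def nth index summand
    using False by (simp add: sum_distrib_left)
qed

theorem theorem20:
  fixes N p :: nat and x :: "nat \<Rightarrow> 'a::field_char_0" and z :: 'a and n :: int
  assumes "N \<ge> 1" and "p \<ge> 1"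
    and "z = (\<Sum>j=1..p. x j)"
    and "n \<ge> 0"
  shows "hyp_bernoulli_sum N p n x =
           (\<Sum>k=0..p-1.
              (\<Sum>\<sigma>\<in>subsets_of_size (p - 1) k.
                 weight (coeff_a N) (coeff_b N z) ({1..p-1} - \<sigma>) \<sigma> n)
              * hyp_bernoulli N (n - int k) z)"
proof -
  let ?w = "\<lambda>\<sigma>. weight (coeff_a N) (coeff_b N z) ({1..p-1} - \<sigma>) \<sigma> n"
  have p: "p = Suc (p - 1)" using assms(2) by simp
  have card: "card ` Pow {1..p-1} \<subseteq> {0..p-1}"
    using card_mono[of "{1..p-1}"] by fastforce
  have "hyp_bernoulli_sum N p n x = power_coeff N z p n"
    using hyp_bernoulli_sum_eq_power_coeff[OF assms(1)] assms(3) by simp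
  also have "\<dots> = (\<Sum>\<sigma>\<in>Pow {1..p-1}. ?w \<sigma> * hyp_bernoulli N (n - int (card \<sigma>)) z)"
    by (subst p, subst two_term_recurrence_solution[where h = "power_coeff N z",
          OF power_coeff_recurrence[OF assms(1)]])
       (simp_all only: power_coeff_one[OF assms(1)])
  also have "\<dots> = (\<Sum>k=0..p-1. \<Sum>\<sigma>\<in>{\<sigma> \<in> Pow {1..p-1}. card \<sigma> = k}.
      ?w \<sigma> * hyp_bernoulli N (n - int (card \<sigma>)) z)"
    by (rule sum.group[OF _ _ card, symmetric]) simp_all
  also have "\<dots> = (\<Sum>k=0..p-1. (\<Sum>\<sigma>\<in>subsets_of_size (p - 1) k. ?w \<sigma>) * hyp_bernoulli N (n - int k) z)"
    unfolding sum_distrib_right by (intro sum.cong) (auto simp: subsets_of_size_def)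
  finally show ?thesis .
qed

end
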